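(* For every $r\ge 3$ and $t\ge 2$, \[ \gamma_{r-1}^+(\mathcal D_{r,t+1})\le 1-\frac1t-\frac{1}{36t^2}. \]
   Context: An $r$-graph is a collection of $r$-element subsets (edges) of a finite vertex set. For an $r$-graph $\mathcal H$ and an $(r-1)$-set $S$ of vertices, $d_{\mathcal H}(S)$ is the number of edges containing $S$. For a nonempty $r$-graph $\mathcal H$, the positive $(r-1)$-codegree is $\delta_{r-1}^+(\mathcal H)=\min\{d_{\mathcal H}(S): S\in\binom{V(\mathcal H)}{r-1},\ d_{\mathcal H}(S)>0\}$. For an $r$-graph $F$, $\operatorname{co\text{-}ex}_{r-1}^+(n,F)$ is the maximum of $\delta_{r-1}^+(\mathcal H)$ over all $F$-free (containing no copy of $F$ as a subgraph) $r$-graphs $\mathcal H$ on $n$ vertices, and $\gamma_{r-1}^+(F)=\lim_{n\to\infty}\operatorname{co\text{-}ex}_{r-1}^+(n,F)/n$ (this limit exists). The $(r,t)$-daisy $\mathcal D_{r,t}$ is the $r$-graph obtained from the complete graph $K_t$ by adding a fixed set of $r-2$ new vertices to each of its edges. *)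

theory Defs
  imports Complex_Main "HOL-Library.Ramsey"
begin

type_synonym 'a hypergraph = "'a set \<times> 'a set set"

abbreviation verts :: "'a hypergraph \<Rightarrow> 'a set" where "verts \<equiv> fst"
abbreviation edges :: "'a hypergraph \<Rightarrow> 'a set set" where "edges \<equiv> snd"

definition r_graph :: "nat \<Rightarrow> 'a hypergraph \<Rightarrow> bool" where
  "r_graph r H \<longleftrightarrow> finite (verts H) \<and> edges H \<subseteq> nsets (verts H) r"

definition set_degree :: "'a hypergraph \<Rightarrow> 'a set \<Rightarrow> nat" where
  "set_degree H S = card {e \<in> edges H. S \<subseteq> e}"

text \<open>Meaningful for \<open>r\<close>-graphs with at least one edge and \<open>r \<ge> 1\<close>; otherwise the minimum is
  taken over the empty set.\<close>

definition pos_codegree :: "nat \<Rightarrow> 'a hypergraph \<Rightarrow> nat" where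
  "pos_codegree r H =
     Min {set_degree H S | S. S \<in> nsets (verts H) (r - 1) \<and> set_degree H S > 0}"

definition contains_copy :: "'a hypergraph \<Rightarrow> 'b hypergraph \<Rightarrow> bool" where
  "contains_copy H F \<longleftrightarrow>
     (\<exists>f. inj_on f (verts F) \<and> f ` verts F \<subseteq> verts H \<and> (\<forall>e\<in>edges F. f ` e \<in> edges H))"

text \<open>Vertices are natural numbers without loss of generality. For fixed \<open>F\<close> with at least two
  edges and \<open>r \<ge> 1\<close>, the maximum is over a nonempty set as soon as \<open>n \<ge> r\<close>, since a single
  edge on \<open>n\<close> vertices is \<open>F\<close>-free.\<close>

definition co_ex_pos :: "nat \<Rightarrow> nat \<Rightarrow> 'b hypergraph \<Rightarrow> nat" where
  "co_ex_pos r n F =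
     Max {pos_codegree r H | H :: nat hypergraph.
            r_graph r H \<and> card (verts H) = n \<and> edges H \<noteq> {} \<and> \<not> contains_copy H F}"

definition pos_codegree_density :: "nat \<Rightarrow> 'b hypergraph \<Rightarrow> real" where
  "pos_codegree_density r F = lim (\<lambda>n. real (co_ex_pos r n F) / real n)"

text \<open>The complete graph lives on \<open>{..<t}\<close>; the \<open>r - 2\<close> new vertices are \<open>{t..<t + (r - 2)}\<close>.\<close>

definition daisy :: "nat \<Rightarrow> nat \<Rightarrow> nat hypergraph" where
  "daisy r t =
     ({..<t + (r - 2)}, {e \<union> {t..<t + (r - 2)} | e. e \<in> nsets {..<t} 2})"

end

theory Submission imports Defs "HOL-Analysis.Convex" begin

text \<open>Any two vertices of a daisy lie in a common edge, so blow-ups of daisy-free graphs are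
  daisy-free; hence the density is a limit that equals the supremum of \<open>co-ex / n\<close>, and it
  suffices to bound the positive codegree of every single daisy-free graph. Passing to the link
  of an \<open>(r - 3)\<close>-set reduces this to \<open>r = 3\<close>.

  Suppose that every pair of positive codegree has codegree at least \<open>(1 - d) n\<close>, and for such a
  pair \<open>v x\<close> let \<open>W(v, x)\<close> be the set of the at most \<open>d n\<close> vertices \<open>z\<close> for which \<open>vxz\<close> is not an
  edge. The link graph of \<open>v\<close> has no \<open>K\<^sub>t\<^sub>+\<^sub>1\<close>, and every vertex \<open>x\<close> of it lies in a \<open>t\<close>-clique \<open>C\<close>.
  The sets \<open>W(v, c)\<close>, \<open>c \<in> C\<close>, cover all vertices, so at most \<open>(td - 1) n\<close> vertices are covered
  twice, and off these vertices they are independent classes of the link. If \<open>d\<close> is close to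
  \<open>1/t\<close>, then \<open>td - 1\<close> is small, and so for a typical edge \<open>vxz\<close> the sets \<open>W(v, z)\<close> and \<open>W(x, z)\<close>
  are almost disjoint. On the other hand, for fixed \<open>v, x\<close> the classes of the links of \<open>v\<close> and of
  \<open>x\<close> cut almost all the vertices outside \<open>W(v, x)\<close> into \<open>(t - 1)\<^sup>2\<close> cells, and
  \<open>W(v, z) \<inter> W(x, z)\<close> contains the cell of \<open>z\<close>, which on average has about \<open>n / t\<^sup>2\<close> elements.\<close>

lemma ex_other_element:
  assumes "card C \<ge> 2"
  shows "\<exists>y\<in>C. y \<noteq> x"
proof (rule ccontr)
  assume "\<not> ?thesis"
  then have "card C \<le> card {x}"
    by (intro card_mono) auto
  then show False
    using assms by simp
qed

lemma card_squared_le_sum_card_fibres: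
  fixes f :: "'a \<Rightarrow> 'b"
  assumes "finite B" "finite I" "f ` B \<subseteq> I"
  shows "(card B)\<^sup>2 \<le> card I * (\<Sum>z\<in>B. card {p \<in> B. f p = f z})"
proof -
  let ?size = "\<lambda>i. card {p \<in> B. f p = i}"
  have "card B = (\<Sum>i\<in>I. ?size i)"
    using sum_fun_comp[OF assms, of "\<lambda>_. 1 :: nat"] by simp
  moreover have "(\<Sum>z\<in>B. ?size (f z)) = (\<Sum>i\<in>I. (?size i)\<^sup>2)"
    using sum_fun_comp[OF assms, of ?size] by (simp add: power2_eq_square)
  moreover have "(\<Sum>i\<in>I. real (?size i))\<^sup>2 \<le> (\<Sum>i\<in>I. (real (?size i))\<^sup>2) * card I"
    by (rule sum_squared_le_sum_of_squares)
  ultimately have "real ((card B)\<^sup>2) \<le> real (card I * (\<Sum>z\<in>B. ?size (f z)))"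
    by (simp add: mult.commute)
  then show ?thesis
    by linarith
qed


lemma card_le_card_Diff_Un3:
  assumes "finite X" "finite Y" "finite Z"
  shows "card A \<le> card (A - (X \<union> (Y \<union> Z))) + (card X + (card Y + card Z))"
proof -
  have "card (X \<union> (Y \<union> Z)) \<le> card X + (card Y + card Z)"
    by (meson add_left_mono card_Un_le order_trans)
  moreover have "card A - card (X \<union> (Y \<union> Z)) \<le> card (A - (X \<union> (Y \<union> Z)))"
    using assms by (intro diff_card_le_card_Diff) auto
  ultimately show ?thesis
    by linarith
qed

lemma card_residue_class_ge:
  fixes k n N :: nat
  assumes "k < n"
  shows "N div n \<le> card {i \<in> {..<N}. i mod n = k}"
proof -
  have "inj_on (\<lambda>j. k + j * n) {..<N div n}"
    using assms by (auto simp: inj_on_def)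
  then have "N div n = card ((\<lambda>j. k + j * n) ` {..<N div n})"
    by (simp add: card_image)
  also have "\<dots> \<le> card {i \<in> {..<N}. i mod n = k}"
  proof (intro card_mono image_subsetI)
    fix j assume "j \<in> {..<N div n}"
    then have "(j + 1) * n \<le> N div n * n"
      by (intro mult_right_mono) auto
    also have "\<dots> \<le> N"
      by simp
    finally show "k + j * n \<in> {i \<in> {..<N}. i mod n = k}"
      using assms by auto
  qed simp
  finally show ?thesis .
qed


section \<open>Dense graphs without large cliques\<close>

text \<open>If \<open>n\<close> vertices are covered by \<open>t\<close> sets of at most \<open>d n\<close> elements each, then the
  multiplicities beyond the first add up to at most \<open>excess t d * n\<close>.\<close>

definition excess :: "nat \<Rightarrow> real \<Rightarrow> real" where
  "excess t d = real t * d - 1"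

locale dense_clique_free_graph =
  fixes V :: "'a set" and R :: "'a \<Rightarrow> 'a \<Rightarrow> bool" and t :: nat and d :: real
  assumes finite_V: "finite V"
    and R_in_V: "R x y \<Longrightarrow> x \<in> V"
    and R_sym: "R x y \<Longrightarrow> R y x"
    and R_irrefl: "\<not> R x x"
    and t_ge_2: "t \<ge> 2"
    and small_d: "(real t - 1) * d < 1"
    and degree_ge: "R x y \<Longrightarrow> (1 - d) * card V \<le> card {z \<in> V. R x z}"
    and clique_free: "\<lbrakk>C \<subseteq> V; pairwise R C\<rbrakk> \<Longrightarrow> card C \<noteq> Suc t"
begin

definition support :: "'a set" where
  "support = {x \<in> V. \<exists>y. R x y}"

definition nonnbrs :: "'a \<Rightarrow> 'a set" where
  "nonnbrs x = {z \<in> V. \<not> R x z}"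

definition arcs :: "'a set \<Rightarrow> ('a \<times> 'a) set" where
  "arcs A = {(x, y) \<in> A \<times> A. R x y}"

definition max_clique :: "'a set \<Rightarrow> bool" where
  "max_clique C \<longleftrightarrow> C \<subseteq> V \<and> pairwise R C \<and> card C = t"

definition multiplicity :: "'a set \<Rightarrow> 'a \<Rightarrow> nat" where
  "multiplicity C p = card {c \<in> C. p \<in> nonnbrs c}"

definition overlap :: "'a set \<Rightarrow> 'a set" where
  "overlap C = {p \<in> V. multiplicity C p > 1}"

lemma finite_nonnbrs [simp]: "finite (nonnbrs x)"
  using finite_V by (simp add: nonnbrs_def)

lemma finite_support [simp]: "finite support"
  using finite_V by (simp add: support_def)

lemma mem_support: "R x y \<Longrightarrow> x \<in> support"
  using R_in_V by (auto simp: support_def)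

lemma card_nonnbrs:
  assumes "x \<in> support"
  shows "card (nonnbrs x) \<le> d * card V"
proof -
  have "nonnbrs x = V - {z \<in> V. R x z}"
    by (auto simp: nonnbrs_def)
  then have "real (card (nonnbrs x)) = card V - real (card {z \<in> V. R x z})"
    using finite_V by (simp add: card_Diff_subset of_nat_diff card_mono)
  then show ?thesis
    using assms degree_ge[of x] by (fastforce simp: support_def algebra_simps)
qed

lemma card_support:
  assumes "support \<noteq> {}"
  shows "(1 - d) * card V \<le> card support"
proof -
  obtain x y where "R x y"
    using assms by (auto simp: support_def)
  then have "(1 - d) * card V \<le> card {z \<in> V. R x z}"
    by (rule degree_ge)
  also have "\<dots> \<le> card support"
    using R_sym by (intro of_nat_mono card_mono finite_support) (auto simp: support_def)
  finally show ?thesis .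
qed

lemma common_neighbour:
  assumes C: "C \<subseteq> support" "C \<noteq> {}" "card C < t"
  obtains z where "z \<in> V" "\<And>c. c \<in> C \<Longrightarrow> R c z"
proof -
  have finC: "finite C"
    using C(1) by (rule finite_subset) simp
  have "card V > 0"
    using C finite_V by (auto simp: support_def card_gt_0_iff)
  have "0 \<le> d * card V"
    using C(1,2) card_nonnbrs by (meson of_nat_0_le_iff order_trans subset_empty subset_eq)
  have "real (card (\<Union>c\<in>C. nonnbrs c)) \<le> (\<Sum>c\<in>C. real (card (nonnbrs c)))"
    using card_UN_le[OF finC, of nonnbrs] by (simp flip: of_nat_sum)
  also have "\<dots> \<le> card C * (d * card V)"
    using C(1) card_nonnbrs by (intro sum_bounded_above) auto
  also have "\<dots> \<le> (real t - 1) * (d * card V)"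
    using C(3) \<open>0 \<le> d * card V\<close> by (intro mult_right_mono) auto
  also have "\<dots> < card V"
    using small_d \<open>card V > 0\<close> mult_strict_right_mono[OF small_d, of "card V"] by simp
  finally have "\<not> V \<subseteq> (\<Union>c\<in>C. nonnbrs c)"
    using finC by (meson card_mono finite_UN finite_nonnbrs not_le of_nat_mono)
  then show ?thesis
    using that by (auto simp: nonnbrs_def)
qed

lemma exists_max_clique:
  assumes "x \<in> support"
  obtains C where "max_clique C" "x \<in> C"
proof -
  have "\<exists>C\<subseteq>V. pairwise R C \<and> card C = Suc k \<and> x \<in> C" if "k < t" for k
    using that
  proof (induction k)
    case 0
    then show ?case
      using assms by (intro exI[of _ "{x}"]) (simp add: support_def)
  next
    case (Suc k)
    then obtain C where C: "C \<subseteq> V" "pairwise R C" "card C = Suc k" "x \<in> C"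
      by auto
    then have "C \<subseteq> support"
      using assms mem_support by (metis pairwise_def subsetI)
    then obtain z where z: "z \<in> V" "\<And>c. c \<in> C \<Longrightarrow> R c z"
      using C Suc.prems by (elim common_neighbour) auto
    then have "z \<notin> C"
      using R_irrefl by blast
    then have "card (insert z C) = Suc (Suc k)"
      using C finite_V by (simp add: finite_subset)
    moreover have "pairwise R (insert z C)"
      using C z R_sym by (simp add: pairwise_insert)
    ultimately show ?case
      using C z by (intro exI[of _ "insert z C"]) simp
  qed
  from this[of "t - 1"] show ?thesis
    using t_ge_2 that by (auto simp: max_clique_def)
qed

lemma finite_max_clique: "max_clique C \<Longrightarrow> finite C"
  using finite_V by (auto simp: max_clique_def intro: finite_subset)

lemma max_clique_subset_support:
  assumes C: "max_clique C"
  shows "C \<subseteq> support"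
proof
  fix c assume "c \<in> C"
  moreover obtain b where "b \<in> C" "b \<noteq> c"
    using ex_other_element[of C c] C t_ge_2 by (auto simp: max_clique_def)
  ultimately have "R c b"
    using C by (auto simp: max_clique_def pairwise_def)
  then show "c \<in> support"
    by (rule mem_support)
qed

lemma max_clique_covers:
  assumes C: "max_clique C" and p: "p \<in> V"
  shows "\<exists>c\<in>C. p \<in> nonnbrs c"
proof (rule ccontr)
  assume "\<not> ?thesis"
  then have nbr: "\<And>c. c \<in> C \<Longrightarrow> R c p"
    using p by (auto simp: nonnbrs_def)
  then have "p \<notin> C"
    using R_irrefl by blast
  then have "card (insert p C) = Suc t"
    using C finite_max_clique by (simp add: max_clique_def)
  moreover have "pairwise R (insert p C)"
    using C nbr R_sym by (simp add: max_clique_def pairwise_insert)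
  ultimately show False
    using clique_free[of "insert p C"] C p by (simp add: max_clique_def)
qed

lemma multiplicity_pos:
  assumes "max_clique C" "p \<in> V"
  shows "multiplicity C p \<ge> 1"
proof -
  have "{c \<in> C. p \<in> nonnbrs c} \<noteq> {}"
    using max_clique_covers[OF assms] by auto
  then show ?thesis
    using finite_max_clique[OF assms(1)] by (simp add: multiplicity_def Suc_le_eq card_gt_0_iff)
qed

lemma sum_multiplicity:
  assumes "finite C"
  shows "(\<Sum>p\<in>V. multiplicity C p) = (\<Sum>c\<in>C. card (nonnbrs c))"
proof -
  have "{p \<in> V. p \<in> nonnbrs c} = nonnbrs c" for c
    by (auto simp: nonnbrs_def)
  then show ?thesis
    unfolding multiplicity_def using finite_V assms by (intro sum_multicount_gen) auto
qed

lemma card_multiplicity_gt: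
  assumes C: "max_clique C"
  shows "m * card {p \<in> V. multiplicity C p > m} \<le> excess t d * card V"
proof -
  let ?A = "{p \<in> V. multiplicity C p > m}"
  have "card V + m * card ?A = (\<Sum>p\<in>V. 1 + (if p \<in> ?A then m else 0))"
    using finite_V by (simp add: sum.distrib sum.If_cases Int_def del: One_nat_def)
  also have "\<dots> \<le> (\<Sum>p\<in>V. multiplicity C p)"
    using multiplicity_pos[OF C] by (intro sum_mono) auto
  also have "\<dots> = (\<Sum>c\<in>C. card (nonnbrs c))"
    using C by (intro sum_multiplicity finite_max_clique)
  finally have "real (card V + m * card ?A) \<le> real (\<Sum>c\<in>C. card (nonnbrs c))"
    by (rule of_nat_mono)
  also have "\<dots> = (\<Sum>c\<in>C. real (card (nonnbrs c)))"
    by (rule of_nat_sum)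
  also have "\<dots> \<le> card C * (d * card V)"
    using max_clique_subset_support[OF C] card_nonnbrs by (intro sum_bounded_above) auto
  finally show ?thesis
    using C by (simp add: max_clique_def excess_def algebra_simps)
qed

lemma card_overlap: "max_clique C \<Longrightarrow> card (overlap C) \<le> excess t d * card V"
  using card_multiplicity_gt[of C 1] by (simp add: overlap_def)

lemma card_isolated:
  assumes "support \<noteq> {}"
  shows "(real t - 1) * card (V - support) \<le> excess t d * card V"
proof -
  obtain C where C: "max_clique C"
    using assms exists_max_clique by blast
  have "multiplicity C p = t" if "p \<in> V - support" for p
  proof -
    have "{c \<in> C. p \<in> nonnbrs c} = C"
      using that R_sym by (auto simp: nonnbrs_def support_def)
    then show ?thesis
      using C by (simp add: multiplicity_def max_clique_def)
  qed
  then have "V - support \<subseteq> {p \<in> V. multiplicity C p > t - 1}"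
    using t_ge_2 by auto
  then have "card (V - support) \<le> card {p \<in> V. multiplicity C p > t - 1}"
    using finite_V by (intro card_mono) auto
  then have "(real t - 1) * card (V - support) \<le> (t - 1) * card {p \<in> V. multiplicity C p > t - 1}"
    using t_ge_2 by (simp add: of_nat_diff mult_left_mono)
  then show ?thesis
    using card_multiplicity_gt[OF C, of "t - 1"] by linarith
qed

text \<open>Otherwise \<open>q\<close> and \<open>q'\<close> could replace \<open>c\<close> in the clique.\<close>

lemma nonnbrs_minus_overlap_independent:
  assumes C: "max_clique C" "c \<in> C"
    and q: "q \<in> nonnbrs c - overlap C" and q': "q' \<in> nonnbrs c - overlap C"
  shows "\<not> R q q'"
proof
  assume adjacent: "R q q'"
  have finC: "finite C"
    using C(1) by (rule finite_max_clique)
  have nbr: "R a p" if p: "p \<in> nonnbrs c - overlap C" and a: "a \<in> C - {c}" for p a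
  proof (rule ccontr)
    assume "\<not> R a p"
    then have "{a, c} \<subseteq> {c \<in> C. p \<in> nonnbrs c}"
      using C p a by (auto simp: nonnbrs_def)
    then have "card {a, c} \<le> multiplicity C p"
      unfolding multiplicity_def using finC by (intro card_mono) auto
    then show False
      using p a by (auto simp: overlap_def nonnbrs_def)
  qed
  let ?C' = "insert q (insert q' (C - {c}))"
  have "q \<notin> C - {c}" "q' \<notin> C - {c}" "q \<noteq> q'"
    using nbr q q' adjacent R_irrefl by blast+
  then have "card ?C' = Suc t"
    using finC C t_ge_2 by (simp add: max_clique_def)
  moreover have "pairwise R ?C'"
    using adjacent nbr q q' R_sym C pairwise_subset[of R C "C - {c}"]
    by (auto simp: pairwise_insert max_clique_def)
  moreover have "?C' \<subseteq> V"
    using C q q' by (auto simp: max_clique_def nonnbrs_def)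
  ultimately show False
    using clique_free by blast
qed

lemma exists_almost_colouring:
  assumes "x \<in> support"
  obtains I and f :: "'a \<Rightarrow> 'a" and X where "finite I" "card I = t - 1" "f ` (V - nonnbrs x) \<subseteq> I"
    and "finite X" "card X \<le> excess t d * card V"
    and "\<forall>p\<in>V - X. \<forall>q\<in>V - X. f p = f q \<longrightarrow> \<not> R p q"
proof -
  obtain C where C: "max_clique C" "x \<in> C"
    using exists_max_clique[OF assms] .
  obtain f where f: "\<And>p. p \<in> V \<Longrightarrow> f p \<in> C \<and> p \<in> nonnbrs (f p)"
    using max_clique_covers[OF C(1)] by metis
  have "card (C - {x}) = t - 1"
    using C finite_max_clique by (simp add: max_clique_def)
  moreover have "f ` (V - nonnbrs x) \<subseteq> C - {x}"
    using f by fastforce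
  moreover have "finite (overlap C)"
    using finite_V by (simp add: overlap_def)
  moreover have "\<forall>p\<in>V - overlap C. \<forall>q\<in>V - overlap C. f p = f q \<longrightarrow> \<not> R p q"
    using nonnbrs_minus_overlap_independent[OF C(1)] f by (metis Diff_iff)
  ultimately show ?thesis
    using that[of "C - {x}" f "overlap C"] card_overlap finite_max_clique C(1) by blast
qed

lemma card_arcs_nonnbrs:
  assumes "p \<in> support"
  shows "card (arcs (nonnbrs p)) \<le> 2 * excess t d * d * (real (card V))\<^sup>2"
proof -
  obtain C where C: "max_clique C" "p \<in> C"
    using exists_max_clique[OF assms] .
  let ?O = "overlap C" and ?N = "nonnbrs p"
  have "arcs ?N \<subseteq> ?O \<times> ?N \<union> ?N \<times> ?O"
    using nonnbrs_minus_overlap_independent[OF C] by (auto simp: arcs_def)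
  then have "card (arcs ?N) \<le> card (?O \<times> ?N \<union> ?N \<times> ?O)"
    using finite_V by (intro card_mono) (auto simp: overlap_def)
  also have "\<dots> \<le> card (?O \<times> ?N) + card (?N \<times> ?O)"
    by (rule card_Un_le)
  also have "\<dots> = 2 * (card ?O * card ?N)"
    by (simp add: card_cartesian_product)
  finally have "real (card (arcs ?N)) \<le> 2 * (real (card ?O) * real (card ?N))"
    by (metis of_nat_mono of_nat_mult of_nat_numeral)
  also have "\<dots> \<le> 2 * ((excess t d * card V) * (d * card V))"
    using card_overlap[OF C(1)] card_nonnbrs[OF assms]
    by (intro mult_left_mono mult_mono) (auto intro: order_trans[OF of_nat_0_le_iff])
  finally show ?thesis
    by (simp add: power2_eq_square mult_ac)
qed

lemma sum_common_nonnbrs_eq: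
  "(\<Sum>(v, x)\<in>arcs V. card (nonnbrs v \<inter> nonnbrs x)) = (\<Sum>p\<in>V. card (arcs (nonnbrs p)))"
proof -
  have "{p \<in> V. p \<in> nonnbrs x \<inter> nonnbrs y} = nonnbrs x \<inter> nonnbrs y" for x y
    by (auto simp: nonnbrs_def)
  then have "(\<Sum>(v, x)\<in>arcs V. card (nonnbrs v \<inter> nonnbrs x))
      = (\<Sum>vx\<in>arcs V. card {p \<in> V. p \<in> nonnbrs (fst vx) \<inter> nonnbrs (snd vx)})"
    by (simp add: case_prod_unfold)
  also have "\<dots> = (\<Sum>p\<in>V. card (arcs (nonnbrs p)))"
  proof (intro sum_multicount_gen ballI)
    show "finite (arcs V)"
      using finite_V by (auto simp: arcs_def intro: finite_subset[of _ "V \<times> V"])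
    show "card {vx \<in> arcs V. p \<in> nonnbrs (fst vx) \<inter> nonnbrs (snd vx)} = card (arcs (nonnbrs p))"
      if "p \<in> V" for p
      using that R_sym by (intro arg_cong[where f = card]) (auto simp: arcs_def nonnbrs_def)
  qed (rule finite_V)
  finally show ?thesis .
qed

lemma sum_card_arcs_nonnbrs_le:
  "(\<Sum>p\<in>V. real (card (arcs (nonnbrs p)))) \<le> card (V - support) * (real (card V))\<^sup>2
    + card support * (2 * excess t d * d * (real (card V))\<^sup>2)"
proof -
  have "(\<Sum>p\<in>V. real (card (arcs (nonnbrs p)))) = (\<Sum>p\<in>V - support. real (card (arcs (nonnbrs p))))
      + (\<Sum>p\<in>support. real (card (arcs (nonnbrs p))))"
    using finite_V by (intro sum.subset_diff) (auto simp: support_def)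
  also have "\<dots> \<le> card (V - support) * (real (card V))\<^sup>2
      + card support * (2 * excess t d * d * (real (card V))\<^sup>2)"
  proof (intro add_mono sum_bounded_above)
    have "card (arcs A) \<le> card (V \<times> V)" if "A \<subseteq> V" for A
      using that finite_V by (intro card_mono) (auto simp: arcs_def)
    then show "real (card (arcs (nonnbrs p))) \<le> (real (card V))\<^sup>2" for p
      by (simp add: nonnbrs_def card_cartesian_product power2_eq_square flip: of_nat_mult)
  qed (fact card_arcs_nonnbrs)
  finally show ?thesis .
qed

lemma sum_common_nonnbrs_le:
  assumes "support \<noteq> {}"
  shows "(real t - 1) * (\<Sum>(v, x)\<in>arcs V. real (card (nonnbrs v \<inter> nonnbrs x)))
    \<le> excess t d * (1 + 2 * (real t - 1) * d) * card V ^ 3"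
proof -
  let ?B = "2 * excess t d * d * (real (card V))\<^sup>2"
  have "(\<Sum>(v, x)\<in>arcs V. real (card (nonnbrs v \<inter> nonnbrs x)))
      = (\<Sum>p\<in>V. real (card (arcs (nonnbrs p))))"
    using sum_common_nonnbrs_eq by (simp add: case_prod_unfold flip: of_nat_sum)
  also have "\<dots> \<le> card (V - support) * (real (card V))\<^sup>2 + card support * ?B"
    by (rule sum_card_arcs_nonnbrs_le)
  finally have "(real t - 1) * (\<Sum>(v, x)\<in>arcs V. real (card (nonnbrs v \<inter> nonnbrs x)))
      \<le> (real t - 1) * (card (V - support) * (real (card V))\<^sup>2 + card support * ?B)"
    using t_ge_2 by (intro mult_left_mono) auto
  also have "\<dots> = (real t - 1) * card (V - support) * (real (card V))\<^sup>2
      + (real t - 1) * (card support * ?B)"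
    by (simp add: algebra_simps)
  also have "\<dots> \<le> excess t d * card V * (real (card V))\<^sup>2 + (real t - 1) * (card V * ?B)"
  proof (intro add_mono mult_right_mono mult_left_mono)
    show "(real t - 1) * card (V - support) \<le> excess t d * card V"
      using assms by (rule card_isolated)
    show "real (card support) \<le> card V"
      using finite_V by (intro of_nat_mono card_mono) (auto simp: support_def)
    show "0 \<le> ?B"
      using assms card_arcs_nonnbrs by (meson of_nat_0_le_iff order_trans ex_in_conv)
  qed (use t_ge_2 in auto)
  also have "\<dots> = excess t d * (1 + 2 * (real t - 1) * d) * card V ^ 3"
    by (simp add: algebra_simps power2_eq_square power3_eq_cube)
  finally show ?thesis .
qed

end


section \<open>Codegrees and daisies\<close>

lemma r_graph_edgeD:
  assumes "r_graph r H" "e \<in> edges H"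
  shows "finite e" "card e = r" "e \<subseteq> verts H"
  using assms by (auto simp: r_graph_def nsets_def)

lemma finite_edges: "r_graph r H \<Longrightarrow> finite (edges H)"
  by (auto simp: r_graph_def intro: finite_subset finite_imp_finite_nsets)

lemma set_degree_pos_iff:
  "r_graph r H \<Longrightarrow> set_degree H S > 0 \<longleftrightarrow> (\<exists>e\<in>edges H. S \<subseteq> e)"
  using finite_edges[of r H] by (auto simp: set_degree_def card_gt_0_iff)

lemma set_degree_eq_card_extensions:
  assumes H: "r_graph r H" and S: "S \<in> nsets (verts H) (r - 1)" and r: "r \<ge> 1"
  shows "set_degree H S = card {u \<in> verts H - S. insert u S \<in> edges H}"
proof -
  let ?A = "{u \<in> verts H - S. insert u S \<in> edges H}"
  have "bij_betw (\<lambda>u. insert u S) ?A {e \<in> edges H. S \<subseteq> e}"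
  proof (rule bij_betwI')
    fix e assume e: "e \<in> {e \<in> edges H. S \<subseteq> e}"
    then have "card (e - S) = 1"
      using S r r_graph_edgeD[OF H] by (auto simp: nsets_def card_Diff_subset)
    then obtain u where u: "e - S = {u}"
      using card_1_singletonE by blast
    then have "e = insert u S"
      using e by auto
    moreover have "u \<in> ?A"
      using u e r_graph_edgeD(3)[OF H, of e] \<open>e = insert u S\<close> by auto
    ultimately show "\<exists>u\<in>?A. e = insert u S"
      by blast
  qed auto
  then show ?thesis
    by (simp add: set_degree_def bij_betw_same_card)
qed

lemma finite_positive_degrees:
  assumes "r_graph r H"
  shows "finite {set_degree H S | S. S \<in> nsets (verts H) k \<and> set_degree H S > 0}"
proof (rule finite_subset)
  show "finite (set_degree H ` nsets (verts H) k)"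
    using assms by (auto simp: r_graph_def finite_imp_finite_nsets)
qed auto

lemma pos_codegree_le_set_degree:
  assumes "r_graph r H" "S \<in> nsets (verts H) (r - 1)" "set_degree H S > 0"
  shows "pos_codegree r H \<le> set_degree H S"
  unfolding pos_codegree_def using assms by (intro Min_le finite_positive_degrees) auto

lemma pos_codegree_attained:
  assumes H: "r_graph r H" and "r \<ge> 1" "edges H \<noteq> {}"
  obtains S where "S \<in> nsets (verts H) (r - 1)" "set_degree H S > 0"
    "set_degree H S = pos_codegree r H"
proof -
  obtain e where e: "e \<in> edges H"
    using assms by auto
  note e_props = r_graph_edgeD[OF H e]
  then obtain x where "x \<in> e"
    using \<open>r \<ge> 1\<close> by fastforce
  then have "e - {x} \<in> nsets (verts H) (r - 1)" "set_degree H (e - {x}) > 0"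
    using e e_props set_degree_pos_iff[OF H] by (auto simp: nsets_def)
  then have "{set_degree H S | S. S \<in> nsets (verts H) (r - 1) \<and> set_degree H S > 0} \<noteq> {}"
    by blast
  from Min_in[OF finite_positive_degrees[OF H] this] show ?thesis
    using that unfolding pos_codegree_def[symmetric] by auto
qed

lemma daisy_edgeI:
  assumes "i < t" "j < t" "i \<noteq> j"
  shows "{i, j} \<union> {t..<t + (r - 2)} \<in> edges (daisy r t)"
  unfolding daisy_def snd_conv using assms by (intro CollectI exI[of _ "{i, j}"]) simp

lemma daisy_edgeE:
  assumes "e \<in> edges (daisy r t)"
  obtains i j where "i < t" "j < t" "i \<noteq> j" "e = {i, j} \<union> {t..<t + (r - 2)}"
proof -
  obtain e' where "e' \<in> nsets {..<t} 2" "e = e' \<union> {t..<t + (r - 2)}"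
    using assms by (auto simp: daisy_def)
  then show ?thesis
    using that by (elim nsets2_E) auto
qed

lemma verts_daisy: "verts (daisy r t) = {..<t} \<union> {t..<t + (r - 2)}"
  by (auto simp: daisy_def)

lemma edges_daisy_subset: "edges (daisy r t) \<subseteq> Pow (verts (daisy r t))"
proof
  fix e assume "e \<in> edges (daisy r t)"
  then show "e \<in> Pow (verts (daisy r t))"
    by (elim daisy_edgeE) (auto simp: verts_daisy)
qed

lemma contains_copy_daisyE:
  assumes "contains_copy H (daisy r t)"
  obtains C P where "C \<in> nsets (verts H) t" "P \<in> nsets (verts H) (r - 2)" "C \<inter> P = {}"
    and "pairwise (\<lambda>x y. {x, y} \<union> P \<in> edges H) C"
proof -
  let ?I = "{t..<t + (r - 2)}"
  obtain f where inj: "inj_on f ({..<t} \<union> ?I)" and sub: "f ` ({..<t} \<union> ?I) \<subseteq> verts H"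
    and edge: "\<And>e. e \<in> edges (daisy r t) \<Longrightarrow> f ` e \<in> edges H"
    using assms unfolding contains_copy_def verts_daisy by blast
  have "f ` {..<t} \<in> nsets (verts H) t" "f ` ?I \<in> nsets (verts H) (r - 2)"
    using sub inj by (auto simp: nsets_def card_image inj_on_Un)
  moreover have "f ` {..<t} \<inter> f ` ?I = {}"
    using inj_on_image_Int[OF inj, of "{..<t}" ?I] by auto
  moreover have "pairwise (\<lambda>x y. {x, y} \<union> f ` ?I \<in> edges H) (f ` {..<t})"
    using edge[OF daisy_edgeI] by (auto simp: pairwise_def image_Un)
  ultimately show ?thesis
    by (rule that)
qed

lemma contains_copy_daisyI:
  assumes C: "C \<in> nsets (verts H) t" and P: "P \<in> nsets (verts H) (r - 2)"
    and disjoint: "C \<inter> P = {}" and edge: "pairwise (\<lambda>x y. {x, y} \<union> P \<in> edges H) C"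
  shows "contains_copy H (daisy r t)"
proof -
  let ?I = "{t..<t + (r - 2)}"
  obtain f where f: "bij_betw f {..<t} C"
    using finite_same_card_bij[of "{..<t}" C] C by (auto simp: nsets_def)
  obtain g where g: "bij_betw g ?I P"
    using finite_same_card_bij[of ?I P] P by (auto simp: nsets_def)
  define h where "h = (\<lambda>i. if i < t then f i else g i)"
  have hC: "bij_betw h {..<t} C"
    using f by (subst bij_betw_cong[of _ h f]) (auto simp: h_def)
  have hP: "bij_betw h ?I P"
    using g by (subst bij_betw_cong[of _ h g]) (auto simp: h_def)
  have h: "bij_betw h (verts (daisy r t)) (C \<union> P)"
    unfolding verts_daisy using hC hP disjoint by (rule bij_betw_combine)
  show ?thesis
    unfolding contains_copy_def
  proof (intro exI[of _ h] conjI ballI)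
    show "inj_on h (verts (daisy r t))" "h ` verts (daisy r t) \<subseteq> verts H"
      using h C P by (auto simp: bij_betw_def nsets_def)
    fix e assume "e \<in> edges (daisy r t)"
    then obtain i j where ij: "i < t" "j < t" "i \<noteq> j" "e = {i, j} \<union> ?I"
      by (rule daisy_edgeE)
    then have "h i \<in> C" "h j \<in> C" "h i \<noteq> h j"
      using hC by (auto simp: bij_betw_def inj_on_def)
    then have "{h i, h j} \<union> P \<in> edges H"
      using edge by (simp add: pairwise_def)
    then show "h ` e \<in> edges H"
      using hP ij(4) by (simp add: bij_betw_def image_Un)
  qed
qed


section \<open>Counting in 3-graphs\<close>

locale dense_daisy_free_3_graph =
  fixes H :: "'a hypergraph" and t :: nat and d :: real
  assumes r_graph_3: "r_graph 3 H"
    and t_ge_2: "t \<ge> 2"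
    and small_d: "(real t - 1) * d < 1"
    and codegree_ge: "{v, x, y} \<in> edges H \<Longrightarrow>
      (1 - d) * card (verts H) \<le> card {z \<in> verts H. {v, x, z} \<in> edges H}"
    and daisy_free: "\<not> contains_copy H (daisy 3 (t + 1))"
begin

lemma edge_distinct: "{x, y, z} \<in> edges H \<Longrightarrow> x \<noteq> y \<and> y \<noteq> z \<and> x \<noteq> z"
  using r_graph_edgeD(2)[OF r_graph_3, of "{x, y, z}"]
  by (auto simp: card_insert_if split: if_splits)

lemma edge_in_verts: "{x, y, z} \<in> edges H \<Longrightarrow> x \<in> verts H \<and> y \<in> verts H \<and> z \<in> verts H"
  using r_graph_edgeD(3)[OF r_graph_3] by auto

sublocale link: dense_clique_free_graph "verts H" "\<lambda>x y. {v, x, y} \<in> edges H" t d for v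
proof
  show "finite (verts H)"
    using r_graph_3 by (simp add: r_graph_def)
  show "card C \<noteq> Suc t"
    if C: "C \<subseteq> verts H" "pairwise (\<lambda>x y. {v, x, y} \<in> edges H) C" for C
  proof
    assume "card C = Suc t"
    then obtain x where "x \<in> C"
      using C(1) by fastforce
    moreover obtain y where "y \<in> C" "y \<noteq> x"
      using ex_other_element[of C x] \<open>card C = Suc t\<close> t_ge_2 by auto
    ultimately have xy: "x \<in> C" "y \<in> C" "x \<noteq> y"
      by auto
    have "v \<notin> C"
    proof
      assume "v \<in> C"
      with xy C(2) edge_distinct show False
        by (metis pairwise_def)
    qed
    moreover have "v \<in> verts H"
      using xy C(2) edge_in_verts by (metis pairwise_def)
    ultimately have "contains_copy H (daisy 3 (t + 1))"
      using C \<open>card C = Suc t\<close> \<open>finite (verts H)\<close>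
      by (intro contains_copy_daisyI[of C _ _ "{v}"])
        (auto simp: nsets_def insert_commute finite_subset pairwise_def)
    then show False
      using daisy_free by contradiction
  qed
  show "{v, y, x} \<in> edges H" if "{v, x, y} \<in> edges H" for x y
    using that by (simp add: insert_commute)
  show "{v, x, x} \<notin> edges H" for x
    using edge_distinct by blast
qed (use edge_in_verts t_ge_2 small_d codegree_ge in blast)+

lemma mem_link_support_commute:
  assumes "x \<in> link.support v"
  shows "v \<in> link.support x"
proof -
  obtain y where "{v, x, y} \<in> edges H"
    using assms by (auto simp: link.support_def)
  then have "{x, v, y} \<in> edges H"
    by (simp add: insert_commute)
  then show ?thesis
    by (rule link.mem_support)
qed

text \<open>Pair an almost-colouring of the link of \<open>v\<close> with one of the link of \<open>x\<close>; outside
  \<open>link.nonnbrs v x\<close>, each of the two loses one colour.\<close>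

lemma exists_common_almost_colouring:
  assumes vx: "x \<in> link.support v"
  obtains B I and h :: "'a \<Rightarrow> 'a \<times> 'a" where "B \<subseteq> verts H - link.nonnbrs v x"
    and "(1 - d - 2 * excess t d) * card (verts H) \<le> card B"
    and "finite I" "card I = (t - 1)\<^sup>2" "h ` B \<subseteq> I"
    and "\<forall>z\<in>B. \<forall>p\<in>B. h p = h z \<longrightarrow> p \<in> link.nonnbrs z v \<inter> link.nonnbrs z x"
proof -
  obtain I and f :: "'a \<Rightarrow> 'a" and X where
    f: "finite I" "card I = t - 1" "f ` (verts H - link.nonnbrs v x) \<subseteq> I"
    and X: "finite X" "card X \<le> excess t d * card (verts H)"
    and f_class: "\<forall>p\<in>verts H - X. \<forall>q\<in>verts H - X. f p = f q \<longrightarrow> {v, p, q} \<notin> edges H"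
    using link.exists_almost_colouring[OF vx] .
  obtain J and g :: "'a \<Rightarrow> 'a" and Y where
    g: "finite J" "card J = t - 1" "g ` (verts H - link.nonnbrs x v) \<subseteq> J"
    and Y: "finite Y" "card Y \<le> excess t d * card (verts H)"
    and g_class: "\<forall>p\<in>verts H - Y. \<forall>q\<in>verts H - Y. g p = g q \<longrightarrow> {x, p, q} \<notin> edges H"
    using link.exists_almost_colouring[OF mem_link_support_commute[OF vx]] .
  have nonnbrs_sym: "link.nonnbrs x v = link.nonnbrs v x"
    unfolding link.nonnbrs_def by (simp add: insert_commute)
  define B where "B = verts H - (link.nonnbrs v x \<union> (X \<union> Y))"
  have card_B: "(1 - d - 2 * excess t d) * card (verts H) \<le> card B"
  proof -
    have "card (verts H) \<le> card B + (card (link.nonnbrs v x) + (card X + card Y))"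
      unfolding B_def using X(1) Y(1) by (intro card_le_card_Diff_Un3) auto
    then have "real (card (verts H)) \<le> card B + (card (link.nonnbrs v x) + (card X + card Y))"
      by linarith
    then show ?thesis
      using link.card_nonnbrs[OF vx] X(2) Y(2) by (simp add: algebra_simps)
  qed
  have same_cell: "p \<in> link.nonnbrs z v \<inter> link.nonnbrs z x"
    if "z \<in> B" "p \<in> B" "(f p, g p) = (f z, g z)" for z p
  proof -
    have "{v, z, p} \<notin> edges H" "{x, z, p} \<notin> edges H" "p \<in> verts H"
      using that f_class g_class by (auto simp: B_def)
    then have "{z, v, p} \<notin> edges H" "{z, x, p} \<notin> edges H"
      by (simp_all add: insert_commute)
    with \<open>p \<in> verts H\<close> show ?thesis
      by (simp add: link.nonnbrs_def)
  qed
  show ?thesis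
  proof (rule that[of B "I \<times> J" "\<lambda>z. (f z, g z)"])
    show "card (I \<times> J) = (t - 1)\<^sup>2"
      using f g by (simp add: card_cartesian_product power2_eq_square)
    show "(\<lambda>z. (f z, g z)) ` B \<subseteq> I \<times> J"
      using f(3) g(3) nonnbrs_sym by (auto simp: B_def)
  qed (use card_B same_cell f(1) g(1) in \<open>auto simp: B_def\<close>)
qed

lemma sum_common_link_nonnbrs_ge:
  assumes vx: "x \<in> link.support v" and d: "d + 2 * excess t d \<le> 1"
  shows "((1 - d - 2 * excess t d) * card (verts H))\<^sup>2 \<le> (real t - 1)\<^sup>2 *
    (\<Sum>z | {v, x, z} \<in> edges H. real (card (link.nonnbrs z v \<inter> link.nonnbrs z x)))"
proof -
  obtain B I and h :: "'a \<Rightarrow> 'a \<times> 'a" where B: "B \<subseteq> verts H - link.nonnbrs v x"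
    and card_B: "(1 - d - 2 * excess t d) * card (verts H) \<le> card B"
    and I: "finite I" "card I = (t - 1)\<^sup>2" "h ` B \<subseteq> I"
    and same_cell: "\<forall>z\<in>B. \<forall>p\<in>B. h p = h z \<longrightarrow> p \<in> link.nonnbrs z v \<inter> link.nonnbrs z x"
    using exists_common_almost_colouring[OF vx] .
  have finB: "finite B"
    using B link.finite_V by (auto intro: finite_subset)
  have "((1 - d - 2 * excess t d) * card (verts H))\<^sup>2 \<le> real ((card B)\<^sup>2)"
    using d card_B by (simp add: power_mono)
  also have "\<dots> \<le> real (card I * (\<Sum>z\<in>B. card {p \<in> B. h p = h z}))"
    using finB I by (intro of_nat_mono card_squared_le_sum_card_fibres)
  also have "\<dots> = (real t - 1)\<^sup>2 * (\<Sum>z\<in>B. real (card {p \<in> B. h p = h z}))"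
    using I t_ge_2 by (simp add: of_nat_diff)
  also have "\<dots> \<le> (real t - 1)\<^sup>2 *
      (\<Sum>z\<in>B. real (card (link.nonnbrs z v \<inter> link.nonnbrs z x)))"
    using same_cell by (intro mult_left_mono sum_mono of_nat_mono card_mono) auto
  also have "\<dots> \<le> (real t - 1)\<^sup>2 *
      (\<Sum>z | {v, x, z} \<in> edges H. real (card (link.nonnbrs z v \<inter> link.nonnbrs z x)))"
  proof (intro mult_left_mono sum_mono2)
    have "{z. {v, x, z} \<in> edges H} \<subseteq> verts H"
      using edge_in_verts by blast
    then show "finite {z. {v, x, z} \<in> edges H}"
      using link.finite_V by (rule finite_subset)
    show "B \<subseteq> {z. {v, x, z} \<in> edges H}"
      using B by (auto simp: link.nonnbrs_def)
  qed auto
  finally show ?thesis .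
qed

definition nonisolated :: "'a set" where
  "nonisolated = {v. link.support v \<noteq> {}}"

definition positive_pairs :: "('a \<times> 'a) set" where
  "positive_pairs = Sigma nonisolated link.support"

lemma mem_positive_pairs_iff: "(v, x) \<in> positive_pairs \<longleftrightarrow> (\<exists>y. {v, x, y} \<in> edges H)"
  using edge_in_verts by (auto simp: positive_pairs_def nonisolated_def link.support_def)

lemma nonisolated_iff: "v \<in> nonisolated \<longleftrightarrow> (\<exists>x y. {v, x, y} \<in> edges H)"
  using edge_in_verts by (auto simp: nonisolated_def link.support_def)

lemma nonisolated_subset_verts: "nonisolated \<subseteq> verts H"
  using edge_in_verts by (auto simp: nonisolated_iff)

lemma finite_nonisolated: "finite nonisolated"
  using nonisolated_subset_verts link.finite_V by (rule finite_subset)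

lemma nonisolated_nonempty:
  assumes "edges H \<noteq> {}"
  shows "nonisolated \<noteq> {}"
proof -
  obtain e where "e \<in> edges H"
    using assms by blast
  then obtain v x y where "{v, x, y} \<in> edges H"
    using r_graph_edgeD(2)[OF r_graph_3] by (metis card_3_iff)
  then show ?thesis
    using nonisolated_iff by blast
qed

lemma card_positive_pairs:
  "card nonisolated * ((1 - d) * card (verts H)) \<le> card positive_pairs"
proof -
  have "card nonisolated * ((1 - d) * card (verts H))
      \<le> (\<Sum>v\<in>nonisolated. real (card (link.support v)))"
    using link.card_support by (intro sum_bounded_below) (auto simp: nonisolated_def)
  then show ?thesis
    using finite_nonisolated by (simp add: positive_pairs_def)
qed

lemma sum_positive_pairs_eq_sum_arcs:
  fixes g :: "'a \<times> 'a \<Rightarrow> 'a \<Rightarrow> real"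
  shows "(\<Sum>vx\<in>positive_pairs. \<Sum>z | {fst vx, snd vx, z} \<in> edges H. g vx z)
    = (\<Sum>z\<in>nonisolated. \<Sum>vx\<in>link.arcs z (verts H). g vx z)"
proof -
  have rotate: "{v, x, z} \<in> edges H \<longleftrightarrow> {z, v, x} \<in> edges H" for v x z
    by (simp add: insert_commute)
  have extensions: "{z. {v, x, z} \<in> edges H} = {z. z \<in> nonisolated \<and> {z, v, x} \<in> edges H}" for v x
    unfolding rotate nonisolated_iff by blast
  have arcs: "link.arcs z (verts H)
      = {vx. vx \<in> positive_pairs \<and> {z, fst vx, snd vx} \<in> edges H}" for z
  proof (rule set_eqI)
    fix vx :: "'a \<times> 'a"
    obtain v x where "vx = (v, x)"
      by fastforce
    then show "vx \<in> link.arcs z (verts H)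
        \<longleftrightarrow> vx \<in> {vx. vx \<in> positive_pairs \<and> {z, fst vx, snd vx} \<in> edges H}"
      using rotate[of v x z] edge_in_verts[of z v x] mem_positive_pairs_iff[of v x]
      by (auto simp: link.arcs_def)
  qed
  have "finite positive_pairs"
    using finite_nonisolated by (simp add: positive_pairs_def)
  then show ?thesis
    unfolding extensions arcs using finite_nonisolated by (intro sum.swap_restrict)
qed

text \<open>Double counting of the quadruples \<open>(v, x, z, p)\<close> such that \<open>vxz\<close> is an edge while neither
  \<open>vzp\<close> nor \<open>xzp\<close> is, from below by fixing \<open>v, x\<close> and from above by fixing \<open>z\<close>.\<close>

lemma counting_inequality:
  assumes nonempty: "edges H \<noteq> {}" and d: "d + 2 * excess t d \<le> 1"
  shows "(1 - d) * (1 - d - 2 * excess t d)\<^sup>2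
    \<le> (real t - 1) * excess t d * (1 + 2 * (real t - 1) * d)"
proof -
  define shared where
    "shared = (\<lambda>(v, x) z. real (card (link.nonnbrs z v \<inter> link.nonnbrs z x)))"
  let ?n = "real (card (verts H))" and ?N = "real (card nonisolated)"
  let ?lower = "((1 - d - 2 * excess t d) * ?n)\<^sup>2"
  let ?upper = "excess t d * (1 + 2 * (real t - 1) * d) * ?n ^ 3"
  have lower: "?lower \<le> (real t - 1)\<^sup>2 * (\<Sum>z | {v, x, z} \<in> edges H. shared (v, x) z)"
    if "(v, x) \<in> positive_pairs" for v x
    using sum_common_link_nonnbrs_ge[OF _ d, of x v] that
    by (simp add: positive_pairs_def shared_def)
  have upper: "(real t - 1) * (\<Sum>vx\<in>link.arcs z (verts H). shared vx z) \<le> ?upper"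
    if "z \<in> nonisolated" for z
    using link.sum_common_nonnbrs_le[of z] that
    by (simp add: nonisolated_def shared_def case_prod_unfold)
  have "?N * ((1 - d) * ?n) * ?lower \<le> card positive_pairs * ?lower"
    using card_positive_pairs by (rule mult_right_mono) simp
  also have "\<dots> \<le> (\<Sum>vx\<in>positive_pairs. (real t - 1)\<^sup>2 *
      (\<Sum>z | {fst vx, snd vx, z} \<in> edges H. shared vx z))"
    using lower by (intro sum_bounded_below) auto
  also have "\<dots> = (real t - 1)\<^sup>2 *
      (\<Sum>z\<in>nonisolated. \<Sum>vx\<in>link.arcs z (verts H). shared vx z)"
    by (simp add: sum_positive_pairs_eq_sum_arcs flip: sum_distrib_left)
  also have "\<dots> = (real t - 1) *
      (\<Sum>z\<in>nonisolated. (real t - 1) * (\<Sum>vx\<in>link.arcs z (verts H). shared vx z))"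
    by (simp add: power2_eq_square flip: sum_distrib_left)
  also have "\<dots> \<le> (real t - 1) * (?N * ?upper)"
    using upper t_ge_2 by (intro mult_left_mono sum_bounded_above) auto
  finally have "(?N * ?n ^ 3) * ((1 - d) * (1 - d - 2 * excess t d)\<^sup>2)
      \<le> (?N * ?n ^ 3) * ((real t - 1) * excess t d * (1 + 2 * (real t - 1) * d))"
    by (simp add: mult_ac power2_eq_square power3_eq_cube)
  moreover have "?N * ?n ^ 3 > 0"
  proof -
    have "nonisolated \<noteq> {}" "verts H \<noteq> {}"
      using nonisolated_nonempty[OF nonempty] nonisolated_subset_verts by blast+
    then show ?thesis
      using finite_nonisolated link.finite_V by (simp add: card_gt_0_iff)
  qed
  ultimately show ?thesis
    by (simp only: mult_le_cancel_left_pos)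
qed

end

definition critical_deficit :: "nat \<Rightarrow> real" where
  "critical_deficit t = 1 / real t + 1 / (36 * (real t)\<^sup>2)"

lemma excess_critical_deficit: "t > 0 \<Longrightarrow> excess t (critical_deficit t) = 1 / (36 * real t)"
  by (simp add: excess_def critical_deficit_def field_simps power2_eq_square)

lemma critical_deficit_le:
  assumes "t \<ge> 2"
  shows "critical_deficit t \<le> 73 / 144"
proof -
  have "1 / real t \<le> 1 / 2"
    using assms by (intro divide_left_mono) auto
  moreover from this have "(1 / real t)\<^sup>2 \<le> (1 / 2)\<^sup>2"
    by (rule power_mono) simp
  ultimately show ?thesis
    by (simp add: critical_deficit_def power_divide)
qed

lemma critical_deficit_small:
  assumes "t \<ge> 2"
  shows "(real t - 1) * critical_deficit t < 1"
proof -
  have "(real t - 1) * critical_deficit t = 1 + excess t (critical_deficit t) - critical_deficit t"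
    by (simp add: excess_def algebra_simps)
  also have "\<dots> = 1 + 1 / (36 * real t) - critical_deficit t"
    using assms by (simp add: excess_critical_deficit)
  also have "\<dots> = 1 - (35 / (36 * real t) + 1 / (36 * (real t)\<^sup>2))"
    using assms by (simp add: critical_deficit_def field_simps)
  also have "\<dots> < 1"
  proof -
    have "0 < 35 / (36 * real t)" "0 < 1 / (36 * (real t)\<^sup>2)"
      using assms by simp_all
    then show ?thesis
      by linarith
  qed
  finally show ?thesis .
qed

lemma excess_critical_deficit_le:
  assumes "t \<ge> 2"
  shows "excess t (critical_deficit t) \<le> 1 / 72"
  using assms by (simp add: excess_critical_deficit field_simps)

lemma counting_inequality_fails:
  fixes t :: nat
  assumes t: "t \<ge> 2"
  defines "d \<equiv> critical_deficit t"
  shows "(real t - 1) * excess t d * (1 + 2 * (real t - 1) * d)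
    < (1 - d) * (1 - d - 2 * excess t d)\<^sup>2"
proof -
  have "(real t - 1) * excess t d * (1 + 2 * (real t - 1) * d) \<le> 1 / 36 * 3"
  proof (rule mult_mono)
    show "(real t - 1) * excess t d \<le> 1 / 36"
      using t by (simp add: d_def excess_critical_deficit field_simps)
    show "1 + 2 * (real t - 1) * d \<le> 3"
      using critical_deficit_small[OF t] by (simp add: d_def algebra_simps)
    show "0 \<le> 1 + 2 * (real t - 1) * d"
      using t by (simp add: d_def critical_deficit_def)
  qed simp
  also have "\<dots> < (71 / 144) * (67 / 144)\<^sup>2"
    by (simp add: power2_eq_square)
  also have "\<dots> \<le> (1 - d) * (1 - d - 2 * excess t d)\<^sup>2"
    using critical_deficit_le[OF t] excess_critical_deficit_le[OF t]
    unfolding d_def by (intro mult_mono power_mono) auto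
  finally show ?thesis .
qed

lemma pos_codegree_daisy_free_3_graph_le:
  assumes t: "t \<ge> 2" and H: "r_graph 3 H" "edges H \<noteq> {}"
    and free: "\<not> contains_copy H (daisy 3 (t + 1))"
  shows "pos_codegree 3 H \<le> (1 - critical_deficit t) * card (verts H)"
proof (rule ccontr)
  let ?d = "critical_deficit t"
  assume "\<not> ?thesis"
  then have large: "(1 - ?d) * card (verts H) \<le> pos_codegree 3 H"
    by simp
  have codegree: "pos_codegree 3 H \<le> card {z \<in> verts H. {v, x, z} \<in> edges H}"
    if "{v, x, y} \<in> edges H" for v x y
  proof -
    have "card {v, x, y} = 3" "{v, x, y} \<subseteq> verts H"
      using r_graph_edgeD[OF H(1) that] by auto
    then have S: "{v, x} \<in> nsets (verts H) (3 - 1)"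
      by (auto simp: nsets_def card_insert_if split: if_splits)
    have "pos_codegree 3 H \<le> set_degree H {v, x}"
      using that set_degree_pos_iff[OF H(1)] by (intro pos_codegree_le_set_degree[OF H(1) S]) blast
    also have "\<dots> = card {z \<in> verts H - {v, x}. insert z {v, x} \<in> edges H}"
      using set_degree_eq_card_extensions[OF H(1) S] by simp
    also have "\<dots> \<le> card {z \<in> verts H. {v, x, z} \<in> edges H}"
      using H(1) by (intro card_mono) (auto simp: r_graph_def insert_commute)
    finally show ?thesis .
  qed
  interpret dense_daisy_free_3_graph H t ?d
    using assms critical_deficit_small[OF t] codegree
    by unfold_locales (auto intro: order_trans[OF large])
  have "?d + 2 * excess t ?d \<le> 1"
    using critical_deficit_le[OF t] excess_critical_deficit_le[OF t] by linarith
  from counting_inequality[OF H(2) this] show False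
    using counting_inequality_fails[OF t] by linarith
qed


section \<open>Reduction to 3-graphs\<close>

definition link :: "'a hypergraph \<Rightarrow> 'a set \<Rightarrow> 'a hypergraph" where
  "link H S = (verts H, {e. e \<inter> S = {} \<and> e \<union> S \<in> edges H})"

lemma verts_link [simp]: "verts (link H S) = verts H"
  by (simp add: link_def)

lemma mem_edges_link: "e \<in> edges (link H S) \<longleftrightarrow> e \<inter> S = {} \<and> e \<union> S \<in> edges H"
  by (simp add: link_def)

lemma r_graph_link:
  assumes H: "r_graph r H" and S: "finite S"
  shows "r_graph (r - card S) (link H S)"
proof -
  have "e \<in> nsets (verts H) (r - card S)" if "e \<in> edges (link H S)" for e
  proof -
    have e: "e \<inter> S = {}" "e \<union> S \<in> edges H"
      using that by (auto simp: mem_edges_link)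
    note props = r_graph_edgeD[OF H e(2)]
    then have "card e + card S = r"
      using e(1) S by (simp add: card_Un_disjoint)
    then show ?thesis
      using props by (auto simp: nsets_def)
  qed
  then show ?thesis
    using H by (auto simp: r_graph_def)
qed

lemma set_degree_link:
  assumes "T \<inter> S = {}"
  shows "set_degree (link H S) T = set_degree H (T \<union> S)"
proof -
  have "bij_betw (\<lambda>e. e \<union> S) {e \<in> edges (link H S). T \<subseteq> e} {e \<in> edges H. T \<union> S \<subseteq> e}"
  proof (rule bij_betw_byWitness[where f' = "\<lambda>e. e - S"])
    show "(\<lambda>e. e - S) ` {e \<in> edges H. T \<union> S \<subseteq> e} \<subseteq> {e \<in> edges (link H S). T \<subseteq> e}"
      using assms by (auto simp: mem_edges_link Un_absorb2)
  qed (auto simp: mem_edges_link)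
  then show ?thesis
    by (simp add: set_degree_def bij_betw_same_card)
qed

lemma pos_codegree_le_pos_codegree_link:
  assumes H: "r_graph r H" and S: "finite S" "card S < r" and ne: "edges (link H S) \<noteq> {}"
  shows "pos_codegree r H \<le> pos_codegree (r - card S) (link H S)"
proof -
  note L = r_graph_link[OF H S(1)]
  obtain T where T: "T \<in> nsets (verts H) (r - card S - 1)" "set_degree (link H S) T > 0"
    and attained: "set_degree (link H S) T = pos_codegree (r - card S) (link H S)"
    using pos_codegree_attained[OF L _ ne] S(2) unfolding verts_link
    by (metis One_nat_def Suc_leI zero_less_diff)
  obtain e where "T \<subseteq> e" "e \<inter> S = {}" "e \<union> S \<in> edges H"
    using T(2) unfolding set_degree_pos_iff[OF L] Bex_def mem_edges_link by metis
  then have "T \<inter> S = {}" "S \<subseteq> verts H"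
    using r_graph_edgeD(3)[OF H] by blast+
  then have "T \<union> S \<in> nsets (verts H) (r - 1)"
    using T(1) S by (auto simp: nsets_def card_Un_disjoint)
  moreover have degree: "set_degree H (T \<union> S) = set_degree (link H S) T"
    using set_degree_link[OF \<open>T \<inter> S = {}\<close>] by simp
  ultimately have "pos_codegree r H \<le> set_degree H (T \<union> S)"
    using T(2) by (intro pos_codegree_le_set_degree[OF H]) simp_all
  then show ?thesis
    by (simp add: degree attained)
qed

lemma contains_copy_daisy_link:
  assumes H: "r_graph r H" and S: "finite S" "card S + 2 \<le> r" and t: "t \<ge> 2"
    and copy: "contains_copy (link H S) (daisy (r - card S) t)"
  shows "contains_copy H (daisy r t)"
proof -
  obtain C P where C: "C \<in> nsets (verts H) t" and P: "P \<in> nsets (verts H) (r - card S - 2)"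
    and disjoint: "C \<inter> P = {}" and edge: "pairwise (\<lambda>x y. {x, y} \<union> P \<in> edges (link H S)) C"
    using contains_copy_daisyE[OF copy] unfolding verts_link .
  have other: "\<exists>y\<in>C. y \<noteq> x" for x
    using C t by (intro ex_other_element) (simp add: nsets_def)
  have "x \<notin> S" "P \<inter> S = {}" "S \<subseteq> verts H" if "x \<in> C" for x
  proof -
    obtain y where "y \<in> C" "y \<noteq> x"
      using other by blast
    then have "{x, y} \<union> P \<in> edges (link H S)"
      using edge \<open>x \<in> C\<close> by (simp add: pairwise_def)
    then show "x \<notin> S" "P \<inter> S = {}" "S \<subseteq> verts H"
      using r_graph_edgeD(3)[OF H, of "{x, y} \<union> P \<union> S"] by (auto simp: mem_edges_link)
  qed
  moreover have "C \<noteq> {}"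
    using other by blast
  ultimately have "C \<inter> (P \<union> S) = {}" "P \<inter> S = {}" "S \<subseteq> verts H"
    using disjoint by blast+
  moreover from this have "P \<union> S \<in> nsets (verts H) (r - 2)"
    using P S by (auto simp: nsets_def card_Un_disjoint)
  moreover have "pairwise (\<lambda>x y. {x, y} \<union> (P \<union> S) \<in> edges H) C"
    using edge by (simp add: pairwise_def mem_edges_link Un_assoc)
  ultimately show ?thesis
    using C by (intro contains_copy_daisyI)
qed

lemma pos_codegree_daisy_free_le:
  assumes r: "r \<ge> 3" and t: "t \<ge> 2" and H: "r_graph r H" "edges H \<noteq> {}"
    and free: "\<not> contains_copy H (daisy r (t + 1))"
  shows "pos_codegree r H \<le> (1 - critical_deficit t) * card (verts H)"
proof -
  obtain e where e: "e \<in> edges H"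
    using H(2) by blast
  then obtain S where S: "S \<subseteq> e" "card S = r - 3" "finite S"
    using r_graph_edgeD[OF H(1)] obtain_subset_with_card_n[of "r - 3" e] by auto
  have r_eq: "r - card S = 3"
    using S(2) r by simp
  have "(e - S) \<union> S = e"
    using S(1) by blast
  then have ne: "edges (link H S) \<noteq> {}"
    using e mem_edges_link[of "e - S" H S] by auto
  have "pos_codegree r H \<le> pos_codegree 3 (link H S)"
    using pos_codegree_le_pos_codegree_link[OF H(1) S(3) _ ne] r r_eq by simp
  also have "\<dots> \<le> (1 - critical_deficit t) * card (verts (link H S))"
  proof (rule pos_codegree_daisy_free_3_graph_le[OF t _ ne])
    show "r_graph 3 (link H S)"
      using r_graph_link[OF H(1) S(3)] r_eq by simp
    show "\<not> contains_copy (link H S) (daisy 3 (t + 1))"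
      using contains_copy_daisy_link[OF H(1) S(3)] free r r_eq t by auto
  qed
  finally show ?thesis
    by simp
qed


section \<open>Blow-ups\<close>

definition blow_up :: "nat \<Rightarrow> ('b \<Rightarrow> 'a) \<Rightarrow> 'b set \<Rightarrow> 'a hypergraph \<Rightarrow> 'b hypergraph" where
  "blow_up r \<phi> W H = (W, {e \<in> nsets W r. \<phi> ` e \<in> edges H})"

definition covers_pairs :: "'a hypergraph \<Rightarrow> bool" where
  "covers_pairs F \<longleftrightarrow> (\<forall>a\<in>verts F. \<forall>b\<in>verts F. \<exists>e\<in>edges F. a \<in> e \<and> b \<in> e)"

lemma verts_blow_up [simp]: "verts (blow_up r \<phi> W H) = W"
  by (simp add: blow_up_def)

lemma mem_edges_blow_up:
  "e \<in> edges (blow_up r \<phi> W H) \<longleftrightarrow> e \<in> nsets W r \<and> \<phi> ` e \<in> edges H"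
  by (simp add: blow_up_def)

lemma r_graph_blow_up: "finite W \<Longrightarrow> r_graph r (blow_up r \<phi> W H)"
  by (auto simp: r_graph_def mem_edges_blow_up)

lemma inj_on_blow_up_edge:
  assumes "r_graph r H" "e \<in> edges (blow_up r \<phi> W H)"
  shows "inj_on \<phi> e"
  using assms r_graph_edgeD(2)[OF assms(1), of "\<phi> ` e"]
  by (intro eq_card_imp_inj_on) (auto simp: mem_edges_blow_up nsets_def)

lemma edges_blow_up_nonempty:
  assumes H: "r_graph r H" "edges H \<noteq> {}" and onto: "verts H \<subseteq> \<phi> ` W"
  shows "edges (blow_up r \<phi> W H) \<noteq> {}"
proof -
  obtain e where e: "e \<in> edges H"
    using H(2) by blast
  then have "e \<subseteq> \<phi> ` W"
    using r_graph_edgeD(3)[OF H(1)] onto by blast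
  then obtain e' where e': "e' \<subseteq> W" "inj_on \<phi> e'" "e = \<phi> ` e'"
    using subset_image_inj by metis
  then have "e' \<in> nsets W r"
    using r_graph_edgeD(1,2)[OF H(1) e] by (simp add: nsets_def card_image finite_image_iff)
  then show ?thesis
    using e e'(3) mem_edges_blow_up by blast
qed

text \<open>As any two vertices of \<open>F\<close> lie in a common edge, a copy of \<open>F\<close> meets each class of the blow-up
  at most once.\<close>

lemma contains_copy_blow_up:
  assumes F: "covers_pairs F" and H: "r_graph r H" and into: "\<phi> ` W \<subseteq> verts H"
    and copy: "contains_copy (blow_up r \<phi> W H) F"
  shows "contains_copy H F"
proof -
  obtain f where inj: "inj_on f (verts F)" and f: "f ` verts F \<subseteq> W"
    and edge: "\<And>e. e \<in> edges F \<Longrightarrow> f ` e \<in> edges (blow_up r \<phi> W H)"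
    using copy unfolding contains_copy_def verts_blow_up by blast
  have "inj_on (\<phi> \<circ> f) (verts F)"
  proof (rule inj_onI)
    fix a b assume ab: "a \<in> verts F" "b \<in> verts F" "(\<phi> \<circ> f) a = (\<phi> \<circ> f) b"
    then obtain e where e: "e \<in> edges F" "a \<in> e" "b \<in> e"
      using F by (auto simp: covers_pairs_def)
    then have "f a = f b"
      using inj_onD[OF inj_on_blow_up_edge[OF H edge[OF e(1)]], of "f a" "f b"] ab(3) e by simp
    then show "a = b"
      by (rule inj_onD[OF inj]) fact+
  qed
  moreover have "(\<phi> \<circ> f) ` verts F \<subseteq> verts H"
    using f into by auto
  moreover have "(\<phi> \<circ> f) ` e \<in> edges H" if "e \<in> edges F" for e
    using edge[OF that] by (simp add: mem_edges_blow_up image_comp)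
  ultimately show ?thesis
    unfolding contains_copy_def by blast
qed

lemma set_degree_blow_up_ge:
  assumes H: "r_graph r H" and r: "r \<ge> 1" and W: "finite W" "\<phi> ` W \<subseteq> verts H"
    and S: "S \<in> nsets W (r - 1)" "inj_on \<phi> S"
    and fibres: "\<And>u. u \<in> verts H \<Longrightarrow> m \<le> card {i \<in> W. \<phi> i = u}"
  shows "m * set_degree H (\<phi> ` S) \<le> set_degree (blow_up r \<phi> W H) S"
proof -
  define A where "A = {u \<in> verts H - \<phi> ` S. insert u (\<phi> ` S) \<in> edges H}"
  have "\<phi> ` S \<in> nsets (verts H) (r - 1)"
    using S W(2) by (auto simp: nsets_def card_image)
  then have "m * set_degree H (\<phi> ` S) = card A * m"
    using set_degree_eq_card_extensions[OF H _ r] by (simp add: A_def)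
  also have "\<dots> \<le> (\<Sum>u\<in>A. card {i \<in> W. \<phi> i = u})"
    using fibres by (intro sum_bounded_below[where 'a = nat, simplified]) (auto simp: A_def)
  also have "\<dots> = card (\<Union>u\<in>A. {i \<in> W. \<phi> i = u})"
    using W(1) H by (intro card_UN_disjoint[symmetric]) (auto simp: A_def r_graph_def)
  also have "\<dots> \<le> card {y \<in> W - S. insert y S \<in> edges (blow_up r \<phi> W H)}"
  proof (intro card_mono subsetI)
    fix y assume "y \<in> (\<Union>u\<in>A. {i \<in> W. \<phi> i = u})"
    then have y: "y \<in> W" "\<phi> y \<notin> \<phi> ` S" "insert (\<phi> y) (\<phi> ` S) \<in> edges H"
      by (auto simp: A_def)
    then have "y \<notin> S"
      by blast
    then show "y \<in> {y \<in> W - S. insert y S \<in> edges (blow_up r \<phi> W H)}"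
      using y S(1) r by (auto simp: mem_edges_blow_up nsets_def)
  qed (use W(1) in auto)
  also have "\<dots> = set_degree (blow_up r \<phi> W H) S"
    using set_degree_eq_card_extensions[OF r_graph_blow_up[OF W(1), of r \<phi> H] _ r, of S] S(1)
    by simp
  finally show ?thesis .
qed

lemma pos_codegree_blow_up_ge:
  assumes H: "r_graph r H" "edges H \<noteq> {}" and r: "r \<ge> 1"
    and W: "finite W" "\<phi> ` W = verts H"
    and fibres: "\<And>u. u \<in> verts H \<Longrightarrow> m \<le> card {i \<in> W. \<phi> i = u}"
  shows "m * pos_codegree r H \<le> pos_codegree r (blow_up r \<phi> W H)"
proof -
  let ?B = "blow_up r \<phi> W H"
  have B: "r_graph r ?B" "edges ?B \<noteq> {}"
    using H W by (simp_all add: r_graph_blow_up edges_blow_up_nonempty)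
  obtain S where S: "S \<in> nsets W (r - 1)" "set_degree ?B S > 0"
    and attained: "set_degree ?B S = pos_codegree r ?B"
    using pos_codegree_attained[OF B(1) r B(2)] by auto
  obtain e where e: "e \<in> edges ?B" "S \<subseteq> e"
    using S(2) set_degree_pos_iff[OF B(1)] by blast
  then have inj: "inj_on \<phi> S"
    using inj_on_blow_up_edge[OF H(1)] inj_on_subset by blast
  then have "\<phi> ` S \<in> nsets (verts H) (r - 1)"
    using S(1) W(2) by (auto simp: nsets_def card_image)
  moreover have "set_degree H (\<phi> ` S) > 0"
    using e set_degree_pos_iff[OF H(1)] by (auto simp: mem_edges_blow_up)
  ultimately have "pos_codegree r H \<le> set_degree H (\<phi> ` S)"
    by (rule pos_codegree_le_set_degree[OF H(1)])
  then have "m * pos_codegree r H \<le> m * set_degree H (\<phi> ` S)"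
    by simp
  also have "\<dots> \<le> set_degree ?B S"
    using set_degree_blow_up_ge[OF H(1) r W(1) equalityD1[OF W(2)] S(1) inj fibres] .
  finally show ?thesis
    by (simp add: attained)
qed

lemma exists_balanced_map:
  assumes V: "finite V" "V \<noteq> {}" and N: "card V \<le> N"
  obtains \<phi> :: "nat \<Rightarrow> 'a" where "\<phi> ` {..<N} = V"
    and "\<And>u. u \<in> V \<Longrightarrow> N div card V \<le> card {i \<in> {..<N}. \<phi> i = u}"
proof -
  define n where "n = card V"
  have n: "n > 0" "n \<le> N"
    using assms by (simp_all add: n_def card_gt_0_iff)
  obtain h where h: "bij_betw h {0..<n} V"
    using ex_bij_betw_nat_finite[OF V(1)] by (auto simp: n_def)
  let ?\<phi> = "\<lambda>i. h (i mod n)"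
  have preimage: "\<exists>k<n. h k = u" if "u \<in> V" for u
    using that h by (auto simp: bij_betw_def)
  have "?\<phi> ` {..<N} \<subseteq> V"
    using bij_betw_apply[OF h] n by auto
  moreover have "u \<in> ?\<phi> ` {..<N}" if "u \<in> V" for u
  proof -
    obtain k where "k < n" "h k = u"
      using preimage[OF \<open>u \<in> V\<close>] by blast
    then show ?thesis
      using n(2) by (intro image_eqI[of _ _ k]) auto
  qed
  ultimately have "?\<phi> ` {..<N} = V"
    by blast
  moreover have "N div card V \<le> card {i \<in> {..<N}. ?\<phi> i = u}" if "u \<in> V" for u
  proof -
    obtain k where k: "k < n" "h k = u"
      using preimage[OF \<open>u \<in> V\<close>] by blast
    have "N div card V \<le> card {i \<in> {..<N}. i mod n = k}"
      using card_residue_class_ge[OF k(1)] by (simp add: n_def)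
    also have "\<dots> \<le> card {i \<in> {..<N}. ?\<phi> i = u}"
      using k(2) by (intro card_mono) auto
    finally show ?thesis .
  qed
  ultimately show ?thesis
    by (rule that)
qed

lemma covers_pairs_daisy:
  assumes "t \<ge> 2"
  shows "covers_pairs (daisy r t)"
  unfolding covers_pairs_def
proof (intro ballI)
  let ?I = "{t..<t + (r - 2)}"
  fix a b assume ab: "a \<in> verts (daisy r t)" "b \<in> verts (daisy r t)"
  have "card ({a, b} \<inter> {..<t}) \<le> card {a, b}"
    by (intro card_mono) auto
  also have "\<dots> \<le> 2"
    by (simp add: card_insert_if)
  finally obtain e where "{a, b} \<inter> {..<t} \<subseteq> e" "e \<subseteq> {..<t}" "card e = 2"
    using exists_subset_between[of "{a, b} \<inter> {..<t}" 2 "{..<t}"] assms by auto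
  then obtain i j where "i < t" "j < t" "i \<noteq> j" "{a, b} \<inter> {..<t} \<subseteq> {i, j}"
    by (auto simp: card_2_iff)
  then have "{i, j} \<union> ?I \<in> edges (daisy r t)" "a \<in> {i, j} \<union> ?I" "b \<in> {i, j} \<union> ?I"
    using ab daisy_edgeI by (auto simp: verts_daisy)
  then show "\<exists>e\<in>edges (daisy r t). a \<in> e \<and> b \<in> e"
    by (intro bexI conjI)
qed


section \<open>The positive codegree density\<close>

definition free_graphs :: "nat \<Rightarrow> nat \<Rightarrow> 'b hypergraph \<Rightarrow> nat hypergraph set" where
  "free_graphs r n F =
     {H. r_graph r H \<and> card (verts H) = n \<and> edges H \<noteq> {} \<and> \<not> contains_copy H F}"

lemma co_ex_pos_eq: "co_ex_pos r n F = Max (pos_codegree r ` free_graphs r n F)"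
  by (simp only: co_ex_pos_def free_graphs_def image_Collect)

lemma pos_codegree_le_card_verts:
  assumes "r_graph r H" "edges H \<noteq> {}" "r \<ge> 1"
  shows "pos_codegree r H \<le> card (verts H)"
proof -
  obtain S where S: "S \<in> nsets (verts H) (r - 1)" "set_degree H S = pos_codegree r H"
    using assms by (metis pos_codegree_attained)
  have "pos_codegree r H = card {u \<in> verts H - S. insert u S \<in> edges H}"
    using set_degree_eq_card_extensions[OF assms(1) S(1) assms(3)] S(2) by simp
  also have "\<dots> \<le> card (verts H)"
    using assms(1) by (intro card_mono) (auto simp: r_graph_def)
  finally show ?thesis .
qed

lemma finite_pos_codegree_free_graphs:
  assumes "r \<ge> 1"
  shows "finite (pos_codegree r ` free_graphs r n F)"
proof (rule finite_subset)
  show "pos_codegree r ` free_graphs r n F \<subseteq> {..n}"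
    using pos_codegree_le_card_verts assms by (auto simp: free_graphs_def)
qed simp

lemma pos_codegree_le_co_ex_pos:
  assumes "r \<ge> 1" "H \<in> free_graphs r n F"
  shows "pos_codegree r H \<le> co_ex_pos r n F"
  unfolding co_ex_pos_eq using assms by (intro Max_ge finite_pos_codegree_free_graphs imageI)

lemma co_ex_pos_attained:
  assumes "r \<ge> 1" "free_graphs r n F \<noteq> {}"
  obtains H where "H \<in> free_graphs r n F" "pos_codegree r H = co_ex_pos r n F"
  using Max_in[OF finite_pos_codegree_free_graphs[OF assms(1)], of n F] assms(2) that
  unfolding co_ex_pos_eq[symmetric] by force

lemma blow_up_mem_free_graphs:
  assumes F: "covers_pairs F" and H: "H \<in> free_graphs r n F" and onto: "\<phi> ` {..<N} = verts H"
  shows "blow_up r \<phi> {..<N} H \<in> free_graphs r N F"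
proof -
  have "r_graph r H" "edges H \<noteq> {}" "\<not> contains_copy H F"
    using H by (auto simp: free_graphs_def)
  then have "edges (blow_up r \<phi> {..<N} H) \<noteq> {}" "\<not> contains_copy (blow_up r \<phi> {..<N} H) F"
    using F onto edges_blow_up_nonempty contains_copy_blow_up by (metis order_refl)+
  then show ?thesis
    by (simp add: free_graphs_def r_graph_blow_up)
qed

lemma co_ex_pos_blow_up:
  assumes F: "covers_pairs F" and r: "r \<ge> 1" and ne: "free_graphs r n F \<noteq> {}" and N: "n \<le> N"
  shows "N div n * co_ex_pos r n F \<le> co_ex_pos r N F"
proof -
  obtain H where H: "H \<in> free_graphs r n F" and extremal: "pos_codegree r H = co_ex_pos r n F"
    using co_ex_pos_attained[OF r ne] .
  then have rH: "r_graph r H" "edges H \<noteq> {}" and n: "card (verts H) = n"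
    by (auto simp: free_graphs_def)
  obtain e where e: "e \<in> edges H"
    using rH(2) by blast
  have "finite (verts H)" "verts H \<noteq> {}"
    using rH(1) r r_graph_edgeD[OF rH(1) e] by (auto simp: r_graph_def)
  then obtain \<phi> :: "nat \<Rightarrow> nat" where onto: "\<phi> ` {..<N} = verts H"
    and fibres: "\<And>u. u \<in> verts H \<Longrightarrow> N div n \<le> card {i \<in> {..<N}. \<phi> i = u}"
    using exists_balanced_map[of "verts H" N] n N by metis
  have "N div n * pos_codegree r H \<le> pos_codegree r (blow_up r \<phi> {..<N} H)"
    using pos_codegree_blow_up_ge[OF rH r _ onto fibres] by simp
  also have "\<dots> \<le> co_ex_pos r N F"
    using blow_up_mem_free_graphs[OF F H onto] by (rule pos_codegree_le_co_ex_pos[OF r])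
  finally show ?thesis
    by (simp add: extremal)
qed

lemma free_graphs_nonempty:
  assumes F: "edges F \<subseteq> Pow (verts F)" "e \<in> edges F" "e' \<in> edges F" "e \<noteq> e'" and n: "r \<le> n"
  shows "free_graphs r n F \<noteq> {}"
proof -
  let ?H = "({..<n}, {{..<r}}) :: nat hypergraph"
  have "\<not> contains_copy ?H F"
  proof
    assume "contains_copy ?H F"
    then obtain f where "inj_on f (verts F)" "f ` e = {..<r}" "f ` e' = {..<r}"
      using F(2,3) unfolding contains_copy_def by auto
    then show False
      using F inj_on_image_eq_iff[of f "verts F" e e'] by auto
  qed
  then have "?H \<in> free_graphs r n F"
    using n by (auto simp: free_graphs_def r_graph_def nsets_def)
  then show ?thesis
    by blast
qed

lemma ratio_diff_le_ratio:
  fixes n N a b :: nat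
  assumes "n > 0" "n \<le> N" and div_le: "N div n * a \<le> b"
  shows "real a / n - real a / N \<le> real b / N"
proof -
  have pos: "real n > 0" "real N > 0"
    using assms by auto
  have "N \<le> (N div n + 1) * n"
    using pos by (simp add: dividend_less_div_times less_imp_le)
  then have "real N \<le> (real (N div n) + 1) * real n"
    by (metis of_nat_1 of_nat_add of_nat_mono of_nat_mult)
  then have "real N / n - 1 \<le> N div n"
    using pos by (simp add: field_simps)
  then have "(real N / n - 1) * a \<le> real (N div n) * a"
    by (rule mult_right_mono) simp
  also have "\<dots> \<le> b"
    using div_le by (simp flip: of_nat_mult)
  finally have "(real N / n - 1) * a / N \<le> real b / N"
    by (rule divide_right_mono) simp
  also have "(real N / n - 1) * a / N = real a / n - real a / N"
    using pos by (simp add: field_simps)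
  finally show ?thesis .
qed

lemma tendsto_SUP_ratio:
  fixes a :: "nat \<Rightarrow> nat"
  assumes r: "r \<ge> 1" and bdd: "bdd_above ((\<lambda>n. real (a n) / real n) ` {r..})"
    and blow_up: "\<And>n N. \<lbrakk>r \<le> n; n \<le> N\<rbrakk> \<Longrightarrow> N div n * a n \<le> a N"
  shows "(\<lambda>n. real (a n) / real n) \<longlonglongrightarrow> (SUP n\<in>{r..}. real (a n) / real n)"
proof (rule order_tendstoI)
  fix y assume "y < (SUP n\<in>{r..}. real (a n) / real n)"
  then obtain n where n: "r \<le> n" "y < real (a n) / n"
    using less_cSUP_iff[OF _ bdd] by auto
  have ratio_ge: "real (a n) / n - real (a n) / N \<le> real (a N) / N" if "n \<le> N" for N
    using ratio_diff_le_ratio[OF _ that blow_up[OF n(1) that]] n(1) r by simp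
  have "(\<lambda>N. real (a n) / n - real (a n) / real N) \<longlonglongrightarrow> real (a n) / n - 0"
    by (intro tendsto_intros lim_const_over_n)
  then have "\<forall>\<^sub>F N in sequentially. y < real (a n) / n - real (a n) / real N"
    using n(2) by (intro order_tendstoD(1)) auto
  then show "\<forall>\<^sub>F N in sequentially. y < real (a N) / real N"
    using eventually_ge_at_top[of n] by eventually_elim (use ratio_ge in fastforce)
next
  fix y assume y: "(SUP n\<in>{r..}. real (a n) / real n) < y"
  show "\<forall>\<^sub>F N in sequentially. real (a N) / real N < y"
    using eventually_ge_at_top[of r]
    by eventually_elim (use cSUP_upper[OF _ bdd] y in \<open>fastforce intro: le_less_trans\<close>)
qed

lemma pos_codegree_density_le:
  assumes F: "covers_pairs F" "edges F \<subseteq> Pow (verts F)" "e \<in> edges F" "e' \<in> edges F" "e \<noteq> e'"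
    and r: "r \<ge> 1" and bound: "\<And>n H. H \<in> free_graphs r n F \<Longrightarrow> pos_codegree r H \<le> c * real n"
  shows "pos_codegree_density r F \<le> c"
proof -
  have ne: "free_graphs r n F \<noteq> {}" if "r \<le> n" for n
    using free_graphs_nonempty[OF F(2-5) that] .
  have ratio_le: "real (co_ex_pos r n F) / real n \<le> c" if n: "r \<le> n" for n
  proof -
    obtain H where "H \<in> free_graphs r n F" "pos_codegree r H = co_ex_pos r n F"
      using co_ex_pos_attained[OF r ne[OF n]] .
    then show ?thesis
      using bound[of H n] n r by (simp add: pos_divide_le_eq)
  qed
  have "(\<lambda>n. real (co_ex_pos r n F) / real n)
      \<longlonglongrightarrow> (SUP n\<in>{r..}. real (co_ex_pos r n F) / real n)"
    using ratio_le co_ex_pos_blow_up[OF F(1) r ne]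
    by (intro tendsto_SUP_ratio[OF r] bdd_aboveI2[where M = c]) auto
  then have "pos_codegree_density r F = (SUP n\<in>{r..}. real (co_ex_pos r n F) / real n)"
    unfolding pos_codegree_density_def by (rule limI)
  also have "\<dots> \<le> c"
    using ratio_le by (intro cSUP_least) auto
  finally show ?thesis .
qed

theorem theorem1p5:
  fixes r t :: nat
  assumes "r \<ge> 3" and "t \<ge> 2"
  shows "pos_codegree_density r (daisy r (t + 1)) \<le> 1 - 1 / real t - 1 / (36 * (real t)\<^sup>2)"
proof (rule pos_codegree_density_le)
  let ?I = "{t + 1..<t + 1 + (r - 2)}"
  show "covers_pairs (daisy r (t + 1))"
    using assms by (intro covers_pairs_daisy) simp
  show "{0, 1} \<union> ?I \<in> edges (daisy r (t + 1))" "{0, 2} \<union> ?I \<in> edges (daisy r (t + 1))"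
    by (rule daisy_edgeI; use assms in simp)+
  have "1 \<in> {0, 1} \<union> ?I" "1 \<notin> {0, 2} \<union> ?I"
    using assms by simp_all
  then show "{0, 1} \<union> ?I \<noteq> {0, 2} \<union> ?I"
    by metis
  show "pos_codegree r H \<le> (1 - 1 / real t - 1 / (36 * (real t)\<^sup>2)) * real n"
    if "H \<in> free_graphs r n (daisy r (t + 1))" for n H
    using that pos_codegree_daisy_free_le[OF assms, of H]
    by (auto simp: free_graphs_def critical_deficit_def diff_diff_eq)
qed (use assms edges_daisy_subset in auto)

end
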